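(* Let $\mathcal{K}$ be a simplicial complex on the vertex set $[m]=\{1,\dots,m\}$ and $p$ a prime number. Then $$s(\mathcal{K})\le s_p(\mathcal{K})\le m-\left\lceil\log_p\left((p-1)\gamma(\mathcal{K})+1\right)\right\rceil.$$
   Context: A simplicial map is nondegenerate if it is injective on the vertex set of each simplex. For $\mathbf{k}=\mathbb{Z}$ or $\mathbf{k}=\mathbb{F}_p$, $K(\mathbf{k}^r)$ is the simplicial complex whose vertices are the lines in $\mathbf{k}^r$ (rank-one submodules that are direct summands of $\mathbf{k}^r$) and whose simplices are the sets of lines $\{l_1,\dots,l_k\}$ whose span is a direct summand of $\mathbf{k}^r$ of rank $k$. For a simplicial complex $\mathcal{K}$ on $m$ vertices: the (complex) Buchstaber invariant $s(\mathcal{K})$ is $m-r$ with $r$ the least integer such that there is a nondegenerate simplicial map $\mathcal{K}\to K(\mathbb{Z}^r)$ (equivalently, $s(\mathcal{K})$ is the maximal dimension of a toric subgroup of $T^m$ acting freely on the moment angle complex $\mathcal{Z}_{\mathcal{K}}$); the mod $p$ Buchstaber invariant $s_p(\mathcal{K})$ is $m-r$ with $r$ the least integer such that there is a nondegenerate simplicial map $\mathcal{K}\to K(\mathbb{F}_p^r)$. The chromatic number $\gamma(\mathcal{K})$ is the least integer such that there is a nondegenerate simplicial map $\mathcal{K}\to\Delta^{\gamma(\mathcal{K})-1}$, where $\Delta^{d}$ is the full $d$-dimensional simplex. *)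

theory Defs
  imports Complex_Main "HOL-Algebra.IntRing" "HOL-Number_Theory.Residues"
begin

section \<open>Submodules of a free module of finite rank\<close>

text \<open>The free module \<open>R\<^sup>r\<close>, with coordinates indexed by \<open>{..<r}\<close>.
  A module is not a ring: the inherited fields \<open>mult\<close> and \<open>one\<close> carry no meaning.\<close>

definition free_module :: "('a, 'c) ring_scheme \<Rightarrow> nat \<Rightarrow> ('a, nat \<Rightarrow> 'a) module" where
  "free_module R r =
    \<lparr>carrier = {..<r} \<rightarrow>\<^sub>E carrier R,
     mult = undefined,
     one = undefined,
     zero = (\<lambda>i\<in>{..<r}. \<zero>\<^bsub>R\<^esub>),
     add = (\<lambda>v w. \<lambda>i\<in>{..<r}. v i \<oplus>\<^bsub>R\<^esub> w i),
     smult = (\<lambda>a v. \<lambda>i\<in>{..<r}. a \<otimes>\<^bsub>R\<^esub> v i)\<rparr>"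

lemma free_module_is_module:
  assumes "cring R"
  shows "module R (free_module R r)"
proof -
  interpret R: cring R by fact
  let ?C = "{..<r} \<rightarrow>\<^sub>E carrier R"
  have ext: "v = w"
    if "v \<in> ?C" "w \<in> ?C" "\<And>i. i < r \<Longrightarrow> v i = w i" for v w
    using that by (intro PiE_ext) auto
  have comp [simp]: "v i \<in> carrier R" if "v \<in> ?C" "i < r" for v i
    using that by auto
  have add [simp]: "(\<lambda>i\<in>{..<r}. v i \<oplus>\<^bsub>R\<^esub> w i) \<in> ?C" if "v \<in> ?C" "w \<in> ?C" for v w
    using that by (intro restrict_PiE_iff[THEN iffD2]) simp
  have smult [simp]: "(\<lambda>i\<in>{..<r}. a \<otimes>\<^bsub>R\<^esub> v i) \<in> ?C" if "a \<in> carrier R" "v \<in> ?C" for a v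
    using that by (intro restrict_PiE_iff[THEN iffD2]) simp
  have zero [simp]: "(\<lambda>i\<in>{..<r}. \<zero>\<^bsub>R\<^esub>) \<in> ?C"
    by simp
  have uminus: "(\<lambda>i\<in>{..<r}. \<ominus>\<^bsub>R\<^esub> v i) \<in> ?C" if "v \<in> ?C" for v
    using that by (intro restrict_PiE_iff[THEN iffD2]) simp
  have "abelian_group (free_module R r)"
  proof (rule abelian_groupI, unfold free_module_def, simp_all del: restrict_apply)
    fix v assume v: "v \<in> ?C"
    show "\<exists>w\<in>?C. (\<lambda>i\<in>{..<r}. w i \<oplus>\<^bsub>R\<^esub> v i) = (\<lambda>i\<in>{..<r}. \<zero>\<^bsub>R\<^esub>)"
      using v by (intro bexI[OF _ uminus[OF v]] ext) (simp_all add: R.l_neg)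
  qed (rule ext; simp add: R.a_ac)+
  then show ?thesis
    by (rule moduleI[OF assms]; simp add: free_module_def)
       (rule ext; simp add: R.l_distr R.r_distr R.m_assoc)+
qed

definition direct_summand ::
  "('a, 'c) ring_scheme \<Rightarrow> ('a, 'b, 'd) module_scheme \<Rightarrow> 'b set \<Rightarrow> bool" where
  "direct_summand R M N \<longleftrightarrow> submodule N R M \<and>
    (\<exists>N'. submodule N' R M \<and> N \<inter> N' = {\<zero>\<^bsub>M\<^esub>} \<and> N <+>\<^bsub>M\<^esub> N' = carrier M)"

definition module_basis ::
  "('a, 'c) ring_scheme \<Rightarrow> ('a, 'b, 'd) module_scheme \<Rightarrow> 'b set \<Rightarrow> 'b set \<Rightarrow> bool" where
  "module_basis R M N B \<longleftrightarrow> finite B \<and> B \<subseteq> N \<and>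
    (\<forall>x\<in>N. \<exists>!c. c \<in> B \<rightarrow>\<^sub>E carrier R \<and> x = (\<Oplus>\<^bsub>M\<^esub>b\<in>B. c b \<odot>\<^bsub>M\<^esub> b))"

text \<open>The rank is that of a free module. Over a principal ideal domain this loses no generality,
  since every submodule of \<open>R\<^sup>r\<close> is then free.\<close>

definition has_rank ::
  "('a, 'c) ring_scheme \<Rightarrow> ('a, 'b, 'd) module_scheme \<Rightarrow> 'b set \<Rightarrow> nat \<Rightarrow> bool" where
  "has_rank R M N k \<longleftrightarrow> (\<exists>B. module_basis R M N B \<and> card B = k)"

definition module_span ::
  "('a, 'c) ring_scheme \<Rightarrow> ('a, 'b, 'd) module_scheme \<Rightarrow> 'b set \<Rightarrow> 'b set" where
  "module_span R M S = (\<lambda>N. submodule N R M) hull S"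

definition lines ::
  "('a, 'c) ring_scheme \<Rightarrow> ('a, 'b, 'd) module_scheme \<Rightarrow> 'b set set" where
  "lines R M = {l. direct_summand R M l \<and> has_rank R M l 1}"


section \<open>Simplicial complexes and nondegenerate maps\<close>

text \<open>A complex is given by its set of simplices, including the empty one. Every element of the
  vertex set \<open>V\<close> is a vertex of the complex, so that \<open>V = \<Union>K\<close>.\<close>

definition abstract_simplicial_complex :: "'v set \<Rightarrow> 'v set set \<Rightarrow> bool" where
  "abstract_simplicial_complex V K \<longleftrightarrow>
    {} \<in> K \<and> (\<forall>v\<in>V. {v} \<in> K) \<and> (\<forall>\<sigma>\<in>K. finite \<sigma> \<and> \<sigma> \<subseteq> V) \<and>
    (\<forall>\<sigma>\<in>K. \<forall>\<tau>. \<tau> \<subseteq> \<sigma> \<longrightarrow> \<tau> \<in> K)"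

definition simplicial_map :: "'v set set \<Rightarrow> 'w set set \<Rightarrow> ('v \<Rightarrow> 'w) \<Rightarrow> bool" where
  "simplicial_map K L f \<longleftrightarrow> (\<forall>\<sigma>\<in>K. f ` \<sigma> \<in> L)"

definition nondegenerate_map :: "'v set set \<Rightarrow> 'w set set \<Rightarrow> ('v \<Rightarrow> 'w) \<Rightarrow> bool" where
  "nondegenerate_map K L f \<longleftrightarrow> simplicial_map K L f \<and> (\<forall>\<sigma>\<in>K. inj_on f \<sigma>)"

text \<open>The complex \<open>K(R\<^sup>r)\<close>.\<close>

definition universal_complex ::
  "('a, 'c) ring_scheme \<Rightarrow> nat \<Rightarrow> (nat \<Rightarrow> 'a) set set set" where
  "universal_complex R r =
    (let M = free_module R r in
     {L. finite L \<and> L \<subseteq> lines R M \<and> direct_summand R M (module_span R M (\<Union>L)) \<and>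
         has_rank R M (module_span R M (\<Union>L)) (card L)})"

text \<open>The full simplex on \<open>n\<close> vertices, that is \<open>\<Delta>\<close> of dimension \<open>n - 1\<close>; it is \<open>{{}}\<close> for \<open>n = 0\<close>.\<close>

definition full_simplex :: "nat \<Rightarrow> nat set set" where
  "full_simplex n = Pow {..<n}"

definition chromatic_number :: "'v set set \<Rightarrow> nat" where
  "chromatic_number K = (LEAST n. \<exists>f. nondegenerate_map K (full_simplex n) f)"


section \<open>Buchstaber invariants\<close>

definition buchstaber_over :: "('a, 'c) ring_scheme \<Rightarrow> 'v set set \<Rightarrow> int" where
  "buchstaber_over R K =
    int (card (\<Union>K)) - int (LEAST r. \<exists>f. nondegenerate_map K (universal_complex R r) f)"

definition buchstaber :: "'v set set \<Rightarrow> int" where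
  "buchstaber K = buchstaber_over \<Z> K"

definition mod_buchstaber :: "nat \<Rightarrow> 'v set set \<Rightarrow> int" where
  "mod_buchstaber p K = buchstaber_over (residue_ring (int p)) K"

end

theory Submission
  imports Defs
begin

text \<open>Reduction modulo \<open>p\<close> of the lines of \<open>\<int>\<^sup>r\<close> is a nondegenerate simplicial map
  \<open>K(\<int>\<^sup>r) \<rightarrow> K(F\<^sub>p\<^sup>r)\<close>: if \<open>\<int>\<^sup>r = N \<oplus> N'\<close> then \<open>N \<inter> p\<int>\<^sup>r = pN\<close>, so
  the reduction of a direct summand is a direct summand of the same rank. Composing with it turns
  a map to \<open>K(\<int>\<^sup>r)\<close> into a map to \<open>K(F\<^sub>p\<^sup>r)\<close>, which gives the first inequality.
  For the second, a nondegenerate map to \<open>K(F\<^sub>p\<^sup>r)\<close> is a colouring of \<open>K\<close> by the lines of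
  \<open>F\<^sub>p\<^sup>r\<close>, and since distinct lines meet only in \<open>0\<close> there are at most
  \<open>(p\<^sup>r - 1) / (p - 1)\<close> of them.\<close>

section \<open>Submodules, spans and bases\<close>

context module
begin

lemma submodule_carrier: "submodule H R M \<Longrightarrow> H \<subseteq> carrier M"
  by (rule submoduleE(1))

lemma submodule_zero: "submodule H R M \<Longrightarrow> \<zero>\<^bsub>M\<^esub> \<in> H"
  using subgroup.one_closed[OF submodule.axioms(1)] by fastforce

text \<open>Negatives are the multiples by \<open>\<ominus> \<one>\<close>, so closure under scalars
  already supplies them.\<close>

lemma submoduleI_closed:
  assumes "H \<subseteq> carrier M" "\<zero>\<^bsub>M\<^esub> \<in> H"
    and "\<And>x y. \<lbrakk>x \<in> H; y \<in> H\<rbrakk> \<Longrightarrow> x \<oplus>\<^bsub>M\<^esub> y \<in> H"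
    and smult: "\<And>a x. \<lbrakk>a \<in> carrier R; x \<in> H\<rbrakk> \<Longrightarrow> a \<odot>\<^bsub>M\<^esub> x \<in> H"
  shows "submodule H R M"
proof (rule submoduleI)
  fix x assume "x \<in> H"
  then show "\<ominus>\<^bsub>M\<^esub> x \<in> H"
    using smult[of "\<ominus> \<one>" x] smult_l_minus[of \<one> x] assms(1) by auto
qed (use assms in auto)

lemma submodule_finsum:
  assumes "submodule H R M" "f \<in> A \<rightarrow> H"
  shows "(\<Oplus>\<^bsub>M\<^esub>a\<in>A. f a) \<in> H"
  using assms(2)
proof (induction A rule: infinite_finite_induct)
  case (insert a A)
  then have "f \<in> insert a A \<rightarrow> carrier M"
    using submodule_carrier[OF assms(1)] by blast
  with insert show ?case
    by (auto simp: M.finsum_insert Pi_def intro: submoduleE(5)[OF assms(1)])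
\<comment> \<open>Over an infinite index set \<open>finsum\<close> is zero by convention, and zero
  lies in every submodule.\<close>
qed (simp_all add: M.finsum_infinite submodule_zero assms)

lemma submodule_set_add:
  assumes "submodule N R M" "submodule N' R M"
  shows "submodule (N <+>\<^bsub>M\<^esub> N') R M"
proof (rule submoduleI_closed)
  note sub = submodule_carrier[OF assms(1)] submodule_carrier[OF assms(2)]
  show "N <+>\<^bsub>M\<^esub> N' \<subseteq> carrier M"
    using sub by (auto simp: set_add_def')
  show "\<zero>\<^bsub>M\<^esub> \<in> N <+>\<^bsub>M\<^esub> N'"
    using submodule_zero assms by (force simp: set_add_def')
next
  note sub = submodule_carrier[OF assms(1)] submodule_carrier[OF assms(2)]
  fix x y assume "x \<in> N <+>\<^bsub>M\<^esub> N'" "y \<in> N <+>\<^bsub>M\<^esub> N'"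
  then obtain a b c d where *: "a \<in> N" "b \<in> N'" "c \<in> N" "d \<in> N'" "x = a \<oplus>\<^bsub>M\<^esub> b" "y = c \<oplus>\<^bsub>M\<^esub> d"
    by (auto simp: set_add_def')
  then have "x \<oplus>\<^bsub>M\<^esub> y = (a \<oplus>\<^bsub>M\<^esub> c) \<oplus>\<^bsub>M\<^esub> (b \<oplus>\<^bsub>M\<^esub> d)"
    using sub by (simp add: subset_iff M.a_ac)
  moreover have "a \<oplus>\<^bsub>M\<^esub> c \<in> N" "b \<oplus>\<^bsub>M\<^esub> d \<in> N'"
    using * submoduleE(5) assms by auto
  ultimately show "x \<oplus>\<^bsub>M\<^esub> y \<in> N <+>\<^bsub>M\<^esub> N'"
    by (auto simp: set_add_def')
next
  note sub = submodule_carrier[OF assms(1)] submodule_carrier[OF assms(2)]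
  fix r x assume r: "r \<in> carrier R" and "x \<in> N <+>\<^bsub>M\<^esub> N'"
  then obtain a b where *: "a \<in> N" "b \<in> N'" "x = a \<oplus>\<^bsub>M\<^esub> b"
    by (auto simp: set_add_def')
  then have "r \<odot>\<^bsub>M\<^esub> x = r \<odot>\<^bsub>M\<^esub> a \<oplus>\<^bsub>M\<^esub> r \<odot>\<^bsub>M\<^esub> b"
    using sub r by (simp add: subset_iff smult_r_distr)
  moreover have "r \<odot>\<^bsub>M\<^esub> a \<in> N" "r \<odot>\<^bsub>M\<^esub> b \<in> N'"
    using * submoduleE(4) assms r by auto
  ultimately show "r \<odot>\<^bsub>M\<^esub> x \<in> N <+>\<^bsub>M\<^esub> N'"
    by (auto simp: set_add_def')
qed

lemma submodule_span:
  assumes "S \<subseteq> carrier M"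
  shows "submodule (module_span R M S) R M"
proof (rule submoduleI_closed)
  show "module_span R M S \<subseteq> carrier M"
    unfolding module_span_def using assms carrier_is_submodule by (rule hull_minimal)
qed (auto simp: module_span_def hull_def submodule_zero intro: submoduleE)

lemma span_minimal: "S \<subseteq> N \<Longrightarrow> submodule N R M \<Longrightarrow> module_span R M S \<subseteq> N"
  unfolding module_span_def by (rule hull_minimal)

lemma span_superset: "S \<subseteq> module_span R M S"
  unfolding module_span_def by (rule hull_subset)

text \<open>Adjoining \<open>l\<close> puts the new span inside \<open>l + N\<close>, where
  \<open>N\<close> is the old span. This is the image of \<open>l \<times> N\<close> under addition,
  so the size grows at most by the factor \<open>card l\<close>. The count stands in for a dimension
  argument when lines are reduced.\<close>

lemma span_Union_card_le:
  assumes "finite L" "\<And>l. l \<in> L \<Longrightarrow> submodule l R M \<and> finite l"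
  shows "finite (module_span R M (\<Union>L)) \<and> card (module_span R M (\<Union>L)) \<le> (\<Prod>l\<in>L. card l)"
  using assms
proof (induction L rule: finite_induct)
  case empty
  have "module_span R M {} \<subseteq> {\<zero>\<^bsub>M\<^esub>}"
    by (intro span_minimal submoduleI_closed) auto
  then show ?case
    using finite_subset card_mono[of "{\<zero>\<^bsub>M\<^esub>}"] by fastforce
next
  case (insert l L)
  let ?N = "module_span R M (\<Union>L)"
  have l: "submodule l R M" "finite l" and L: "\<Union>L \<subseteq> carrier M"
    using insert.prems submodule_carrier by auto
  note N = submodule_span[OF L]
  have fin: "finite ?N" and card: "card ?N \<le> (\<Prod>l\<in>L. card l)"
    using insert by auto
  have eq: "l <+>\<^bsub>M\<^esub> ?N = (\<lambda>(x, y). x \<oplus>\<^bsub>M\<^esub> y) ` (l \<times> ?N)"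
    by (auto simp: set_add_def')
  have "x \<in> l <+>\<^bsub>M\<^esub> ?N" if "x \<in> l" for x
  proof -
    have "x = x \<oplus>\<^bsub>M\<^esub> \<zero>\<^bsub>M\<^esub>"
      using that submodule_carrier[OF l(1)] by auto
    then show ?thesis
      using that submodule_zero[OF N] unfolding set_add_def' by blast
  qed
  moreover have "x \<in> l <+>\<^bsub>M\<^esub> ?N" if "x \<in> \<Union>L" for x
  proof -
    have "x = \<zero>\<^bsub>M\<^esub> \<oplus>\<^bsub>M\<^esub> x" "x \<in> ?N"
      using that L span_superset[of "\<Union>L"] by auto
    then show ?thesis
      using submodule_zero[OF l(1)] unfolding set_add_def' by blast
  qed
  ultimately have sub: "module_span R M (\<Union>(insert l L)) \<subseteq> l <+>\<^bsub>M\<^esub> ?N"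
    by (intro span_minimal submodule_set_add l N) auto
  have fin': "finite (l <+>\<^bsub>M\<^esub> ?N)"
    unfolding eq using l fin by simp
  have "card (module_span R M (\<Union>(insert l L))) \<le> card (l <+>\<^bsub>M\<^esub> ?N)"
    by (rule card_mono[OF fin' sub])
  also have "\<dots> \<le> card l * card ?N"
    unfolding eq using l fin card_image_le[of "l \<times> ?N"] by (simp add: card_cartesian_product)
  also have "\<dots> \<le> (\<Prod>l\<in>insert l L. card l)"
    using insert.hyps mult_le_mono2[OF card] by simp
  finally show ?case
    using finite_subset[OF sub fin'] by blast
qed

text \<open>In \<open>module_basis\<close> a coefficient function is indexed by the basis vectors
  themselves. An injective family \<open>g\<close> lets coefficients live on the index set
  \<open>I\<close> instead: composing with \<open>g\<close> or with its inverse translates one kind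
  of coefficient function into the other, and uniqueness is carried along.\<close>

lemma has_rankI_family:
  assumes "finite I" "inj_on g I" "g ` I \<subseteq> N" "N \<subseteq> carrier M"
    and uniq: "\<And>x. x \<in> N \<Longrightarrow> \<exists>!c. c \<in> I \<rightarrow>\<^sub>E carrier R \<and> x = (\<Oplus>\<^bsub>M\<^esub>i\<in>I. c i \<odot>\<^bsub>M\<^esub> g i)"
  shows "has_rank R M N (card I)"
  unfolding has_rank_def module_basis_def
proof (intro exI[of _ "g ` I"] conjI ballI)
  fix x assume "x \<in> N"
  let ?P = "\<lambda>c. c \<in> I \<rightarrow>\<^sub>E carrier R \<and> x = (\<Oplus>\<^bsub>M\<^esub>i\<in>I. c i \<odot>\<^bsub>M\<^esub> g i)"
  let ?Q = "\<lambda>c. c \<in> g ` I \<rightarrow>\<^sub>E carrier R \<and> x = (\<Oplus>\<^bsub>M\<^esub>b\<in>g ` I. c b \<odot>\<^bsub>M\<^esub> b)"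
  have reindex: "(\<Oplus>\<^bsub>M\<^esub>b\<in>g ` I. c b \<odot>\<^bsub>M\<^esub> b) = (\<Oplus>\<^bsub>M\<^esub>i\<in>I. c (g i) \<odot>\<^bsub>M\<^esub> g i)"
    if "c \<in> g ` I \<rightarrow> carrier R" for c
    using that assms by (intro M.finsum_reindex) (auto simp: Pi_def)
  obtain c where c: "?P c" and c_uniq: "\<And>d. ?P d \<Longrightarrow> d = c"
    using uniq[OF \<open>x \<in> N\<close>] by (elim ex1E) blast
  let ?c = "\<lambda>b\<in>g ` I. c (the_inv_into I g b)"
  have c': "?c (g i) = c i" if "i \<in> I" for i
    using that assms(2) by (simp add: the_inv_into_f_f)
  have mem: "?c \<in> g ` I \<rightarrow>\<^sub>E carrier R"
    using conjunct1[OF c] assms(2) by (auto simp: the_inv_into_f_f)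
  show "\<exists>!c. ?Q c"
  proof (rule ex1I, rule conjI)
    show "?c \<in> g ` I \<rightarrow>\<^sub>E carrier R"
      by (rule mem)
    have "(\<Oplus>\<^bsub>M\<^esub>b\<in>g ` I. ?c b \<odot>\<^bsub>M\<^esub> b) = (\<Oplus>\<^bsub>M\<^esub>i\<in>I. ?c (g i) \<odot>\<^bsub>M\<^esub> g i)"
      using mem by (intro reindex) (simp add: PiE_def del: restrict_apply)
    also have "\<dots> = (\<Oplus>\<^bsub>M\<^esub>i\<in>I. c i \<odot>\<^bsub>M\<^esub> g i)"
      using conjunct1[OF c] assms(3,4)
      by (intro M.finsum_cong') (auto simp: c' Pi_def PiE_def subset_iff simp del: restrict_apply)
    finally show "x = (\<Oplus>\<^bsub>M\<^esub>b\<in>g ` I. ?c b \<odot>\<^bsub>M\<^esub> b)"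
      using conjunct2[OF c] by simp
  next
    fix d assume d: "?Q d"
    then have dR: "d \<in> g ` I \<rightarrow> carrier R"
      by (simp add: PiE_def)
    have "(\<Oplus>\<^bsub>M\<^esub>i\<in>I. restrict (d \<circ> g) I i \<odot>\<^bsub>M\<^esub> g i) = (\<Oplus>\<^bsub>M\<^esub>i\<in>I. d (g i) \<odot>\<^bsub>M\<^esub> g i)"
      using dR assms(3,4) by (intro M.finsum_cong') (auto simp: Pi_def subset_iff)
    also note reindex[OF dR, symmetric]
    also note conjunct2[OF d, symmetric]
    finally have "restrict (d \<circ> g) I = c"
      using dR by (intro c_uniq conjI) auto
    then have "d (g i) = ?c (g i)" if "i \<in> I" for i
      using that c'[OF that] by (auto dest: fun_cong[of _ _ i])
    then show "d = ?c"
      using conjunct1[OF d] mem by (intro PiE_ext[of d "g ` I"]) auto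
  qed
qed (use assms in \<open>auto simp: card_image\<close>)

text \<open>Existence and uniqueness of coefficients make evaluation of linear combinations a
  bijection from \<open>B \<rightarrow>\<^sub>E carrier R\<close> onto \<open>N\<close>.
  Extensionality keeps values off \<open>B\<close> from being counted.\<close>

lemma card_of_rank:
  assumes N: "submodule N R M" and "has_rank R M N k"
  shows "card N = card (carrier R) ^ k"
proof -
  obtain B where basis: "module_basis R M N B" and "card B = k"
    using assms(2) unfolding has_rank_def by blast
  then have B: "finite B" "B \<subseteq> N"
    by (simp_all add: module_basis_def)
  have uniq: "\<exists>!c. c \<in> B \<rightarrow>\<^sub>E carrier R \<and> x = (\<Oplus>\<^bsub>M\<^esub>b\<in>B. c b \<odot>\<^bsub>M\<^esub> b)" if "x \<in> N" for x
    using basis that by (simp add: module_basis_def)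
  let ?f = "\<lambda>c. \<Oplus>\<^bsub>M\<^esub>b\<in>B. c b \<odot>\<^bsub>M\<^esub> b"
  have closed: "?f c \<in> N" if "c \<in> B \<rightarrow>\<^sub>E carrier R" for c
  proof (intro submodule_finsum[OF N] funcsetI submoduleE(4)[OF N])
    fix b assume "b \<in> B"
    then show "c b \<in> carrier R" "b \<in> N"
      using that B by auto
  qed
  have "bij_betw ?f (B \<rightarrow>\<^sub>E carrier R) N"
    unfolding bij_betw_def
  proof
    show "inj_on ?f (B \<rightarrow>\<^sub>E carrier R)"
    proof (rule inj_onI)
      fix c d assume "c \<in> B \<rightarrow>\<^sub>E carrier R" "d \<in> B \<rightarrow>\<^sub>E carrier R" "?f c = ?f d"
      then show "c = d"
        using uniq[OF closed[of c]] by auto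
    qed
    show "?f ` (B \<rightarrow>\<^sub>E carrier R) = N"
    proof
      show "?f ` (B \<rightarrow>\<^sub>E carrier R) \<subseteq> N"
        using closed by (rule image_subsetI)
      show "N \<subseteq> ?f ` (B \<rightarrow>\<^sub>E carrier R)"
      proof
        fix x assume "x \<in> N"
        then show "x \<in> ?f ` (B \<rightarrow>\<^sub>E carrier R)"
          using ex1_implies_ex[OF uniq] by auto
      qed
    qed
  qed
  then show ?thesis
    using B \<open>card B = k\<close> by (simp add: bij_betw_same_card[symmetric] card_PiE)
qed

end

lemma finsum_free_module:
  assumes "cring R" "finite A" "c \<in> A \<rightarrow> carrier R" "g \<in> A \<rightarrow> carrier (free_module R r)"
  shows "(\<Oplus>\<^bsub>free_module R r\<^esub>a\<in>A. c a \<odot>\<^bsub>free_module R r\<^esub> g a) =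
    (\<lambda>i\<in>{..<r}. \<Oplus>\<^bsub>R\<^esub>a\<in>A. c a \<otimes>\<^bsub>R\<^esub> g a i)"
proof -
  interpret module R "free_module R r"
    by (rule free_module_is_module) fact
  show ?thesis
    using assms(2-)
  proof (induction A rule: finite_induct)
    case empty
    show ?case
      unfolding M.finsum_empty R.finsum_empty by (simp add: free_module_def)
  next
    case (insert a A)
    have g: "g b i \<in> carrier R" if "b \<in> insert a A" "i < r" for b i
      using insert.prems that by (auto simp: free_module_def)
    have "(\<Oplus>\<^bsub>free_module R r\<^esub>a\<in>insert a A. c a \<odot>\<^bsub>free_module R r\<^esub> g a) =
      c a \<odot>\<^bsub>free_module R r\<^esub> g a \<oplus>\<^bsub>free_module R r\<^esub>
        (\<lambda>i\<in>{..<r}. \<Oplus>\<^bsub>R\<^esub>a\<in>A. c a \<otimes>\<^bsub>R\<^esub> g a i)"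
      using insert by (subst M.finsum_insert) (simp_all add: Pi_def del: restrict_apply)
    also have "\<dots> = (\<lambda>i\<in>{..<r}. c a \<otimes>\<^bsub>R\<^esub> g a i \<oplus>\<^bsub>R\<^esub> (\<Oplus>\<^bsub>R\<^esub>a\<in>A. c a \<otimes>\<^bsub>R\<^esub> g a i))"
      by (auto simp: free_module_def)
    also have "\<dots> = (\<lambda>i\<in>{..<r}. \<Oplus>\<^bsub>R\<^esub>a\<in>insert a A. c a \<otimes>\<^bsub>R\<^esub> g a i)"
      using insert g by (intro restrict_ext) (subst R.finsum_insert; auto simp: Pi_def)
    finally show ?case .
  qed
qed

section \<open>Coordinate submodules\<close>

text \<open>Vectors supported on \<open>S\<close>. Singletons give the coordinate axes and
  \<open>- S\<close> gives a complement, so one notion covers the lines, their spans and the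
  complementary summands.\<close>

definition coordinate_submodule :: "('a, 'c) ring_scheme \<Rightarrow> nat \<Rightarrow> nat set \<Rightarrow> (nat \<Rightarrow> 'a) set" where
  "coordinate_submodule R r S =
    {x \<in> carrier (free_module R r). \<forall>i\<in>{..<r} - S. x i = \<zero>\<^bsub>R\<^esub>}"

definition unit_vector :: "('a, 'c) ring_scheme \<Rightarrow> nat \<Rightarrow> nat \<Rightarrow> nat \<Rightarrow> 'a" where
  "unit_vector R r j = (\<lambda>i\<in>{..<r}. if i = j then \<one>\<^bsub>R\<^esub> else \<zero>\<^bsub>R\<^esub>)"

lemma submodule_coordinate:
  assumes "cring R"
  shows "submodule (coordinate_submodule R r S) R (free_module R r)"
proof -
  interpret R: cring R by fact
  interpret module R "free_module R r"
    by (rule free_module_is_module) fact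
  show ?thesis
    by (rule submoduleI_closed) (auto simp: coordinate_submodule_def free_module_def)
qed

text \<open>The vectors supported on \<open>- S\<close> form a complement: every vector is the sum
  of its part on \<open>S\<close> and its part off \<open>S\<close>.\<close>

lemma direct_summand_coordinate:
  assumes "cring R"
  shows "direct_summand R (free_module R r) (coordinate_submodule R r S)"
proof -
  interpret R: cring R by fact
  let ?C = "coordinate_submodule R r"
  interpret module R "free_module R r"
    by (rule free_module_is_module) fact
  have "?C S \<inter> ?C (- S) = {\<zero>\<^bsub>free_module R r\<^esub>}"
  proof
    show "?C S \<inter> ?C (- S) \<subseteq> {\<zero>\<^bsub>free_module R r\<^esub>}"
    proof
      fix x assume "x \<in> ?C S \<inter> ?C (- S)"
      then have "x \<in> extensional {..<r}" "\<And>i. i < r \<Longrightarrow> x i = \<zero>\<^bsub>R\<^esub>"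
        by (auto simp: coordinate_submodule_def free_module_def PiE_def)
      then show "x \<in> {\<zero>\<^bsub>free_module R r\<^esub>}"
        by (auto simp: free_module_def extensional_def fun_eq_iff)
    qed
    show "{\<zero>\<^bsub>free_module R r\<^esub>} \<subseteq> ?C S \<inter> ?C (- S)"
      by (auto simp: coordinate_submodule_def free_module_def)
  qed
  moreover have "x \<in> ?C S <+>\<^bsub>free_module R r\<^esub> ?C (- S)" if "x \<in> carrier (free_module R r)" for x
  proof -
    let ?y = "\<lambda>T. \<lambda>i\<in>{..<r}. if i \<in> T then x i else \<zero>\<^bsub>R\<^esub>"
    have x: "x i \<in> carrier R" if "i < r" for i
      using \<open>x \<in> carrier (free_module R r)\<close> that by (auto simp: free_module_def)
    then have y: "?y T \<in> ?C T" for T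
      by (simp add: coordinate_submodule_def free_module_def)
    have "x = ?y S \<oplus>\<^bsub>free_module R r\<^esub> ?y (- S)"
    proof
      fix i
      \<comment> \<open>Vectors are extensional functions, so both sides are
        \<open>undefined\<close> outside \<open>{..<r}\<close>.\<close>
      have "x i = undefined" if "\<not> i < r"
        using \<open>x \<in> carrier (free_module R r)\<close> that by (simp add: free_module_def PiE_def extensional_def)
      then show "x i = (?y S \<oplus>\<^bsub>free_module R r\<^esub> ?y (- S)) i"
        using x[of i] by (cases "i < r"; cases "i \<in> S") (simp_all add: free_module_def)
    qed
    then show ?thesis
      unfolding set_add_def' by (intro UN_I[OF y[of S]] UN_I[OF y[of "- S"]]) (simp only: singleton_iff)
  qed
  moreover have "?C S <+>\<^bsub>free_module R r\<^esub> ?C (- S) \<subseteq> carrier (free_module R r)"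
    by (intro submodule_carrier submodule_set_add submodule_coordinate assms)
  ultimately show ?thesis
    unfolding direct_summand_def using submodule_coordinate[OF assms] by blast
qed

lemma unit_vector_mem:
  assumes "cring R" "j \<in> S"
  shows "unit_vector R r j \<in> coordinate_submodule R r S"
proof -
  interpret R: cring R by fact
  show ?thesis
    using assms by (auto simp: unit_vector_def coordinate_submodule_def free_module_def)
qed

lemma finsum_unit_vector:
  assumes "cring R" "S \<subseteq> {..<r}" "c \<in> S \<rightarrow> carrier R"
  shows "(\<Oplus>\<^bsub>free_module R r\<^esub>j\<in>S. c j \<odot>\<^bsub>free_module R r\<^esub> unit_vector R r j) =
    (\<lambda>i\<in>{..<r}. if i \<in> S then c i else \<zero>\<^bsub>R\<^esub>)"
proof -
  interpret R: cring R by fact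
  have S: "finite S"
    using assms(2) finite_subset by blast
  have "(\<Oplus>\<^bsub>R\<^esub>j\<in>S. c j \<otimes>\<^bsub>R\<^esub> unit_vector R r j i) = (if i \<in> S then c i else \<zero>\<^bsub>R\<^esub>)" if "i < r" for i
  proof -
    have "(\<Oplus>\<^bsub>R\<^esub>j\<in>S. c j \<otimes>\<^bsub>R\<^esub> unit_vector R r j i) = (\<Oplus>\<^bsub>R\<^esub>j\<in>S. if i = j then c j else \<zero>\<^bsub>R\<^esub>)"
      using that assms(3) by (intro R.finsum_cong') (auto simp: unit_vector_def Pi_def)
    also have "\<dots> = (if i \<in> S then c i else \<zero>\<^bsub>R\<^esub>)"
    proof (cases "i \<in> S")
      case True
      then show ?thesis
        using R.finsum_singleton[of i S c] S assms(3) by auto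
    next
      case False
      then have "(\<Oplus>\<^bsub>R\<^esub>j\<in>S. if i = j then c j else \<zero>\<^bsub>R\<^esub>) = (\<Oplus>\<^bsub>R\<^esub>j\<in>S. \<zero>\<^bsub>R\<^esub>)"
        by (intro R.finsum_cong') auto
      with False show ?thesis by simp
    qed
    finally show ?thesis .
  qed
  moreover have "unit_vector R r \<in> S \<rightarrow> carrier (free_module R r)"
    by (auto simp: unit_vector_def free_module_def)
  ultimately show ?thesis
    using finsum_free_module[OF assms(1) S assms(3)] by (auto intro: restrict_ext)
qed

lemma finsum_unit_vector_eq:
  assumes "cring R" "S \<subseteq> {..<r}" "x \<in> coordinate_submodule R r S"
  shows "x = (\<Oplus>\<^bsub>free_module R r\<^esub>j\<in>S. x j \<odot>\<^bsub>free_module R r\<^esub> unit_vector R r j)"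
proof -
  have "x \<in> S \<rightarrow> carrier R"
    using assms by (auto simp: coordinate_submodule_def free_module_def)
  note fin = finsum_unit_vector[OF assms(1,2) this]
  have "x \<in> {..<r} \<rightarrow>\<^sub>E carrier R" "\<And>i. i \<in> {..<r} - S \<Longrightarrow> x i = \<zero>\<^bsub>R\<^esub>"
    using assms(3) by (simp_all add: coordinate_submodule_def free_module_def)
  then show ?thesis
    unfolding fin by (auto simp: fun_eq_iff PiE_def extensional_def)
qed

text \<open>The unit vectors with index in \<open>S\<close> are a basis, and the coefficients of
  \<open>x\<close> are its own coordinates \<open>restrict x S\<close>. The vectors are distinct
  because \<one> differs from \<zero>.\<close>

lemma has_rank_coordinate:
  assumes "cring R" "\<one>\<^bsub>R\<^esub> \<noteq> \<zero>\<^bsub>R\<^esub>" "S \<subseteq> {..<r}"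
  shows "has_rank R (free_module R r) (coordinate_submodule R r S) (card S)"
proof -
  interpret R: cring R by fact
  interpret module R "free_module R r"
    by (rule free_module_is_module) fact
  note fin = finsum_unit_vector[OF assms(1,3)]
  show ?thesis
  proof (rule has_rankI_family[of _ "unit_vector R r"])
    show "finite S"
      using assms(3) finite_subset by blast
    show "inj_on (unit_vector R r) S"
    proof (rule inj_onI)
      fix i j assume *: "i \<in> S" "j \<in> S" "unit_vector R r i = unit_vector R r j"
      show "i = j"
        using *(1,2) fun_cong[OF *(3), of i] assms(2,3)
        by (auto simp: unit_vector_def subset_iff split: if_splits)
    qed
    show "coordinate_submodule R r S \<subseteq> carrier (free_module R r)"
      by (auto simp: coordinate_submodule_def)
    fix x assume x: "x \<in> coordinate_submodule R r S"
    show "\<exists>!c. c \<in> S \<rightarrow>\<^sub>E carrier R \<and>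
      x = (\<Oplus>\<^bsub>free_module R r\<^esub>j\<in>S. c j \<odot>\<^bsub>free_module R r\<^esub> unit_vector R r j)"
    proof (rule ex1I[of _ "restrict x S"], intro conjI)
      show mem: "restrict x S \<in> S \<rightarrow>\<^sub>E carrier R"
        using x assms(3) by (auto simp: coordinate_submodule_def free_module_def)
      have x': "x \<in> S \<rightarrow> carrier R" "restrict x S \<in> S \<rightarrow> carrier R"
        using mem x assms(3) by (auto simp: PiE_def coordinate_submodule_def free_module_def)
      have "x = (\<lambda>i\<in>{..<r}. if i \<in> S then x i else \<zero>\<^bsub>R\<^esub>)"
        by (rule trans[OF finsum_unit_vector_eq[OF assms(1,3) x] fin[OF x'(1)]])
      also have "\<dots> = (\<lambda>i\<in>{..<r}. if i \<in> S then restrict x S i else \<zero>\<^bsub>R\<^esub>)"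
        by auto
      also note fin[OF x'(2), symmetric]
      finally show "x = (\<Oplus>\<^bsub>free_module R r\<^esub>j\<in>S. restrict x S j \<odot>\<^bsub>free_module R r\<^esub> unit_vector R r j)" .
      fix c assume c: "c \<in> S \<rightarrow>\<^sub>E carrier R \<and>
        x = (\<Oplus>\<^bsub>free_module R r\<^esub>j\<in>S. c j \<odot>\<^bsub>free_module R r\<^esub> unit_vector R r j)"
      then have c': "c \<in> S \<rightarrow> carrier R"
        by (simp add: PiE_def)
      have "x = (\<lambda>i\<in>{..<r}. if i \<in> S then c i else \<zero>\<^bsub>R\<^esub>)"
        by (rule trans[OF conjunct2[OF c] fin[OF c']])
      from fun_cong[OF this] have "x i = c i" if "i \<in> S" for i
        using that assms(3) by (auto split: if_splits)
      then show "c = restrict x S"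
        using conjunct1[OF c] mem by (intro PiE_ext[of c S "\<lambda>_. carrier R"]) simp_all
    qed
  qed (use unit_vector_mem[OF assms(1)] in blast)
qed

section \<open>Coordinate axes as simplices of \<open>K(R\<^sup>r)\<close>\<close>

lemma span_coordinate_lines:
  assumes "cring R" "S \<subseteq> {..<r}"
  shows "module_span R (free_module R r) (\<Union>i\<in>S. coordinate_submodule R r {i}) =
    coordinate_submodule R r S" (is "module_span R ?M ?U = _")
proof -
  interpret module R ?M
    by (rule free_module_is_module) fact
  have U: "?U \<subseteq> carrier ?M"
    by (auto simp: coordinate_submodule_def)
  note span = submodule_span[OF U]
  show ?thesis
  proof
    show "module_span R ?M ?U \<subseteq> coordinate_submodule R r S"
      by (intro span_minimal submodule_coordinate assms) (auto simp: coordinate_submodule_def)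
    show "coordinate_submodule R r S \<subseteq> module_span R ?M ?U"
    proof
      fix x assume x: "x \<in> coordinate_submodule R r S"
      have "unit_vector R r j \<in> module_span R ?M ?U" if "j \<in> S" for j
        using that unit_vector_mem[OF assms(1), of j "{j}" r] span_superset[of ?U] by blast
      moreover have "x j \<in> carrier R" if "j \<in> S" for j
        using that x assms(2) by (auto simp: coordinate_submodule_def free_module_def)
      ultimately have "(\<Oplus>\<^bsub>?M\<^esub>j\<in>S. x j \<odot>\<^bsub>?M\<^esub> unit_vector R r j) \<in> module_span R ?M ?U"
        by (intro submodule_finsum[OF span]) (auto intro: submoduleE(4)[OF span])
      then show "x \<in> module_span R ?M ?U"
        using finsum_unit_vector_eq[OF assms x] by simp
    qed
  qed
qed

lemma inj_coordinate_lines: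
  assumes "cring R" "\<one>\<^bsub>R\<^esub> \<noteq> \<zero>\<^bsub>R\<^esub>"
  shows "inj_on (\<lambda>i. coordinate_submodule R r {i}) {..<r}"
proof (rule inj_onI)
  fix i j assume *: "i \<in> {..<r}" "j \<in> {..<r}"
    "coordinate_submodule R r {i} = coordinate_submodule R r {j}"
  then have "unit_vector R r i \<in> coordinate_submodule R r {j}"
    using unit_vector_mem[OF assms(1), of i "{i}" r] by simp
  then show "i = j"
    using *(1,2) assms(2)
    by (auto simp: coordinate_submodule_def unit_vector_def split: if_splits)
qed

text \<open>The axes with index in \<open>S\<close> span \<open>coordinate_submodule R r S\<close>,
  a direct summand whose rank is the number of these axes. Thus the \<open>r\<close> axes together
  with all their subsets form a full simplex in \<open>K(R\<^sup>r)\<close>.\<close>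

lemma universal_complex_coordinate:
  assumes "cring R" "\<one>\<^bsub>R\<^esub> \<noteq> \<zero>\<^bsub>R\<^esub>" "S \<subseteq> {..<r}"
  shows "(\<lambda>i. coordinate_submodule R r {i}) ` S \<in> universal_complex R r"
proof -
  have "card ((\<lambda>i. coordinate_submodule R r {i}) ` S) = card S"
    using inj_on_subset[OF inj_coordinate_lines[OF assms(1,2)] assms(3)] by (rule card_image)
  moreover have "coordinate_submodule R r {i} \<in> lines R (free_module R r)" if "i \<in> S" for i
    using that assms(3) direct_summand_coordinate[OF assms(1)]
      has_rank_coordinate[OF assms(1,2), of "{i}" r] by (auto simp: lines_def)
  ultimately show ?thesis
    using direct_summand_coordinate[OF assms(1), of r S] has_rank_coordinate[OF assms]
      span_coordinate_lines[OF assms(1,3)] finite_subset[OF assms(3)]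
    by (auto simp: universal_complex_def Let_def)
qed

text \<open>A numbering \<open>h\<close> of the vertices sends them to distinct axes, and any set of
  axes is a simplex. Hence the \<open>LEAST\<close> in \<open>buchstaber_over\<close> ranges over a
  nonempty set and is attained.\<close>

lemma nondegenerate_map_universal_complex_exists:
  assumes "cring R" "\<one>\<^bsub>R\<^esub> \<noteq> \<zero>\<^bsub>R\<^esub>" "abstract_simplicial_complex V K" "finite V"
  shows "\<exists>f. nondegenerate_map K (universal_complex R (card V)) f"
proof -
  obtain h where h: "bij_betw h V {..<card V}"
    using ex_bij_betw_finite_nat[OF assms(4)] by (auto simp: atLeast0LessThan)
  let ?f = "\<lambda>v. coordinate_submodule R (card V) {h v}"
  have "?f ` \<sigma> \<in> universal_complex R (card V)" "inj_on ?f \<sigma>" if "\<sigma> \<in> K" for \<sigma>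
  proof -
    have \<sigma>: "\<sigma> \<subseteq> V" "h ` \<sigma> \<subseteq> {..<card V}"
      using that assms(3) bij_betwE[OF h] unfolding abstract_simplicial_complex_def by blast+
    show "?f ` \<sigma> \<in> universal_complex R (card V)"
      using universal_complex_coordinate[OF assms(1,2) \<sigma>(2)] by (simp add: image_image)
    have "inj_on ((\<lambda>i. coordinate_submodule R (card V) {i}) \<circ> h) \<sigma>"
      using inj_on_subset[OF bij_betw_imp_inj_on[OF h] \<sigma>(1)]
        inj_on_subset[OF inj_coordinate_lines[OF assms(1,2)] \<sigma>(2)]
      by (rule comp_inj_on)
    then show "inj_on ?f \<sigma>"
      by (simp add: comp_def)
  qed
  then show ?thesis
    unfolding nondegenerate_map_def simplicial_map_def by blast
qed

section \<open>Reduction of integral vectors\<close>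

lemma free_module_ext:
  assumes "x \<in> carrier (free_module R r)" "y \<in> carrier (free_module R r)"
    and "\<And>i. i < r \<Longrightarrow> x i = y i"
  shows "x = y"
  using assms by (intro PiE_ext[of x "{..<r}" "\<lambda>_. carrier R"]) (auto simp: free_module_def)

context residues
begin

text \<open>In this context \<open>m\<close> is the modulus, an integer greater than 1. The ring
  \<open>R\<close> consists of the integers from 0 to \<open>m - 1\<close>, so vectors over
  \<open>R\<close> are themselves integer vectors.\<close>

definition reduce :: "nat \<Rightarrow> (nat \<Rightarrow> int) \<Rightarrow> nat \<Rightarrow> int" where
  "reduce r v = (\<lambda>i\<in>{..<r}. v i mod m)"

lemma module_Z: "module \<Z> (free_module \<Z> r)"
  by (rule free_module_is_module[OF int_is_cring])

lemma module_R: "module R (free_module R r)"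
  by (rule free_module_is_module[OF cring])

lemma mod_carrier [simp]: "a mod m \<in> carrier R"
  using m_gt_one by (simp add: res_carrier_eq)

lemma mod_eq_carrier: "a \<in> carrier R \<Longrightarrow> a mod m = a"
  by (simp add: res_carrier_eq)

lemma reduce_mem: "reduce r v \<in> carrier (free_module R r)"
  using m_gt_one by (simp add: reduce_def free_module_def res_carrier_eq)

lemma reduce_add:
  "reduce r (v \<oplus>\<^bsub>free_module \<Z> r\<^esub> w) = reduce r v \<oplus>\<^bsub>free_module R r\<^esub> reduce r w"
  by (simp add: reduce_def free_module_def res_add_eq fun_eq_iff mod_simps)

lemma reduce_smult:
  "reduce r (a \<odot>\<^bsub>free_module \<Z> r\<^esub> v) = (a mod m) \<odot>\<^bsub>free_module R r\<^esub> reduce r v"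
  by (simp add: reduce_def free_module_def res_mult_eq fun_eq_iff mod_simps)

lemma reduce_zero: "reduce r \<zero>\<^bsub>free_module \<Z> r\<^esub> = \<zero>\<^bsub>free_module R r\<^esub>"
  by (simp add: reduce_def free_module_def res_zero_eq fun_eq_iff)

text \<open>Surjectivity of reduction: a vector over \<open>R\<close> serves as its own integral
  lift.\<close>

lemma residue_vector_lift:
  assumes "w \<in> carrier (free_module R r)"
  shows "w \<in> carrier (free_module \<Z> r)" "reduce r w = w"
proof -
  have w: "w \<in> extensional {..<r}" "\<And>i. i < r \<Longrightarrow> w i \<in> carrier R"
    using assms by (auto simp: free_module_def PiE_def)
  then show "w \<in> carrier (free_module \<Z> r)"
    by (simp add: free_module_def PiE_def)
  show "reduce r w = w"
    using w mod_eq_carrier by (auto simp: reduce_def fun_eq_iff extensional_def)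
qed

lemma reduce_eq_imp:
  assumes "x \<in> carrier (free_module \<Z> r)" "reduce r x = reduce r y"
  shows "\<exists>z\<in>carrier (free_module \<Z> r). \<forall>i<r. x i = y i + m * z i"
proof
  have "x i mod m = y i mod m" if "i < r" for i
    using fun_cong[OF assms(2), of i] that by (simp add: reduce_def)
  then have "m dvd x i - y i" if "i < r" for i
    using that by (simp add: mod_eq_dvd_iff)
  then show "\<forall>i<r. x i = y i + m * (\<lambda>i\<in>{..<r}. (x i - y i) div m) i"
    by simp
  show "(\<lambda>i\<in>{..<r}. (x i - y i) div m) \<in> carrier (free_module \<Z> r)"
    by (simp add: free_module_def)
qed

lemma reduce_finsum:
  assumes "finite A" "g \<in> A \<rightarrow> carrier (free_module \<Z> r)"
  shows "reduce r (\<Oplus>\<^bsub>free_module \<Z> r\<^esub>a\<in>A. c a \<odot>\<^bsub>free_module \<Z> r\<^esub> g a) =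
    (\<Oplus>\<^bsub>free_module R r\<^esub>a\<in>A. (c a mod m) \<odot>\<^bsub>free_module R r\<^esub> reduce r (g a))"
proof -
  interpret Z: module \<Z> "free_module \<Z> r" by (rule module_Z)
  interpret F: module R "free_module R r" by (rule module_R)
  show ?thesis
    using assms
  proof (induction A rule: finite_induct)
    case empty
    show ?case
      unfolding Z.M.finsum_empty F.M.finsum_empty by (rule reduce_zero)
  next
    case (insert a A)
    have "(\<Oplus>\<^bsub>free_module \<Z> r\<^esub>a\<in>insert a A. c a \<odot>\<^bsub>free_module \<Z> r\<^esub> g a) = c a \<odot>\<^bsub>free_module \<Z> r\<^esub> g a
        \<oplus>\<^bsub>free_module \<Z> r\<^esub> (\<Oplus>\<^bsub>free_module \<Z> r\<^esub>a\<in>A. c a \<odot>\<^bsub>free_module \<Z> r\<^esub> g a)"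
      using insert.prems insert.hyps by (intro Z.M.finsum_insert) (auto intro!: Z.smult_closed)
    moreover have "(\<Oplus>\<^bsub>free_module R r\<^esub>a\<in>insert a A. (c a mod m) \<odot>\<^bsub>free_module R r\<^esub> reduce r (g a)) =
        (c a mod m) \<odot>\<^bsub>free_module R r\<^esub> reduce r (g a) \<oplus>\<^bsub>free_module R r\<^esub>
        (\<Oplus>\<^bsub>free_module R r\<^esub>a\<in>A. (c a mod m) \<odot>\<^bsub>free_module R r\<^esub> reduce r (g a))"
      using insert.hyps by (intro F.M.finsum_insert) (auto intro!: F.smult_closed reduce_mem)
    ultimately show ?case
      using insert by (simp add: reduce_add reduce_smult)
  qed
qed

lemma submodule_reduce:
  assumes "submodule N \<Z> (free_module \<Z> r)"
  shows "submodule (reduce r ` N) R (free_module R r)"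
proof -
  interpret Z: module \<Z> "free_module \<Z> r" by (rule module_Z)
  interpret F: module R "free_module R r" by (rule module_R)
  show ?thesis
  proof (rule F.submoduleI_closed)
    show "\<zero>\<^bsub>free_module R r\<^esub> \<in> reduce r ` N"
      using reduce_zero Z.submodule_zero[OF assms] by (metis image_eqI)
  next
    fix x y assume "x \<in> reduce r ` N" "y \<in> reduce r ` N"
    then show "x \<oplus>\<^bsub>free_module R r\<^esub> y \<in> reduce r ` N"
      using Z.submoduleE(5)[OF assms] by (auto simp flip: reduce_add)
  next
    fix a x assume "a \<in> carrier R" "x \<in> reduce r ` N"
    then obtain y where y: "y \<in> N" "x = reduce r y" by blast
    have "a \<odot>\<^bsub>free_module R r\<^esub> x = reduce r (a \<odot>\<^bsub>free_module \<Z> r\<^esub> y)"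
      using \<open>a \<in> carrier R\<close> y by (simp add: reduce_smult mod_eq_carrier)
    then show "a \<odot>\<^bsub>free_module R r\<^esub> x \<in> reduce r ` N"
      using Z.submoduleE(4)[OF assms _ y(1)] by auto
  qed (auto simp: reduce_mem)
qed

lemma submodule_reduce_vimage:
  assumes "submodule N R (free_module R r)"
  shows "submodule {x \<in> carrier (free_module \<Z> r). reduce r x \<in> N} \<Z> (free_module \<Z> r)"
proof -
  interpret Z: module \<Z> "free_module \<Z> r" by (rule module_Z)
  interpret F: module R "free_module R r" by (rule module_R)
  show ?thesis
    by (rule Z.submoduleI_closed)
      (auto simp: reduce_add reduce_smult reduce_zero F.submodule_zero[OF assms]
        intro: F.submoduleE(4,5)[OF assms])
qed

text \<open>Both inclusions come from minimality of a span. The image of the integral span is a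
  submodule containing the reduced set, and the preimage of the reduced span is a submodule
  containing \<open>S\<close>.\<close>

lemma span_reduce:
  assumes "S \<subseteq> carrier (free_module \<Z> r)"
  shows "module_span R (free_module R r) (reduce r ` S) = reduce r ` module_span \<Z> (free_module \<Z> r) S"
proof
  interpret Z: module \<Z> "free_module \<Z> r" by (rule module_Z)
  interpret F: module R "free_module R r" by (rule module_R)
  show "module_span R (free_module R r) (reduce r ` S) \<subseteq> reduce r ` module_span \<Z> (free_module \<Z> r) S"
    by (intro F.span_minimal submodule_reduce Z.submodule_span assms image_mono Z.span_superset)
  have "reduce r ` S \<subseteq> carrier (free_module R r)"
    using reduce_mem by blast
  then have "module_span \<Z> (free_module \<Z> r) S \<subseteq>
      {x \<in> carrier (free_module \<Z> r). reduce r x \<in> module_span R (free_module R r) (reduce r ` S)}"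
    using assms F.span_superset[of "reduce r ` S"]
    by (intro Z.span_minimal submodule_reduce_vimage F.submodule_span) auto
  then show "reduce r ` module_span \<Z> (free_module \<Z> r) S \<subseteq> module_span R (free_module R r) (reduce r ` S)"
    by blast
qed

section \<open>Direct summands, ranks and simplices under reduction\<close>

text \<open>Write \<open>x - w = m z\<close> and split \<open>z = u + u'\<close> along the two
  summands. Then \<open>x - m u = w + m u'\<close> lies in both of them and is therefore zero. The
  case \<open>w = 0\<close> says that an element of \<open>N\<close> divisible by \<open>m\<close>
  is \<open>m\<close> times an element of \<open>N\<close>; a general \<open>w\<close> shows that
  the reductions of \<open>N\<close> and \<open>N'\<close> meet only in zero.\<close>

lemma complement_reduce_eq:
  assumes N: "submodule N \<Z> (free_module \<Z> r)" and N': "submodule N' \<Z> (free_module \<Z> r)"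
    and inter: "N \<inter> N' = {\<zero>\<^bsub>free_module \<Z> r\<^esub>}"
    and sum: "N <+>\<^bsub>free_module \<Z> r\<^esub> N' = carrier (free_module \<Z> r)"
    and x: "x \<in> N" and w: "w \<in> N'" and eq: "reduce r x = reduce r w"
  shows "\<exists>u\<in>N. x = m \<odot>\<^bsub>free_module \<Z> r\<^esub> u"
proof -
  interpret Z: module \<Z> "free_module \<Z> r" by (rule module_Z)
  note carr = subsetD[OF Z.submodule_carrier[OF N]] subsetD[OF Z.submodule_carrier[OF N']]
  obtain z where z: "z \<in> carrier (free_module \<Z> r)" "\<And>i. i < r \<Longrightarrow> x i = w i + m * z i"
    using reduce_eq_imp[OF carr(1)[OF x] eq] by blast
  then obtain u u' where u: "u \<in> N" "u' \<in> N'" "z = u \<oplus>\<^bsub>free_module \<Z> r\<^esub> u'"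
    using sum unfolding set_add_def' by blast
  \<comment> \<open>The same vector written twice, once visibly in \<open>N\<close> and once visibly
    in \<open>N'\<close>.\<close>
  let ?t = "x \<oplus>\<^bsub>free_module \<Z> r\<^esub> (- m) \<odot>\<^bsub>free_module \<Z> r\<^esub> u"
  let ?t' = "w \<oplus>\<^bsub>free_module \<Z> r\<^esub> m \<odot>\<^bsub>free_module \<Z> r\<^esub> u'"
  have t: "?t \<in> N" "?t' \<in> N'"
    using x w u by (auto intro!: Z.submoduleE(4,5) N N')
  have "?t = ?t'"
    by (rule free_module_ext[OF carr(1)[OF t(1)] carr(2)[OF t(2)]])
      (use z(2) u(3) in \<open>simp add: free_module_def algebra_simps\<close>)
  then have "?t \<in> N \<inter> N'"
    using t by (intro IntI) (simp_all only:)
  then have t0: "?t = \<zero>\<^bsub>free_module \<Z> r\<^esub>"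
    unfolding inter by (rule singletonD)
  have "x i = m * u i" if "i < r" for i
    using that fun_cong[OF t0, of i] by (simp add: free_module_def)
  then have "x = m \<odot>\<^bsub>free_module \<Z> r\<^esub> u"
    using carr(1) x u by (intro free_module_ext[of _ \<Z> r] Z.smult_closed) (simp_all add: free_module_def)
  with u(1) show ?thesis by blast
qed

text \<open>The reduction of a complement is a complement. A common element is the reduction of some
  \<open>m u\<close>, hence zero, and sums are inherited because reduction is additive and
  surjective.\<close>

lemma direct_summand_reduce:
  assumes "direct_summand \<Z> (free_module \<Z> r) N"
  shows "direct_summand R (free_module R r) (reduce r ` N)"
proof -
  interpret Z: module \<Z> "free_module \<Z> r" by (rule module_Z)
  interpret F: module R "free_module R r" by (rule module_R)
  obtain N' where N: "submodule N \<Z> (free_module \<Z> r)" and N': "submodule N' \<Z> (free_module \<Z> r)"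
    and inter: "N \<inter> N' = {\<zero>\<^bsub>free_module \<Z> r\<^esub>}"
    and sum: "N <+>\<^bsub>free_module \<Z> r\<^esub> N' = carrier (free_module \<Z> r)"
    using assms unfolding direct_summand_def by blast
  note sub = submodule_reduce[OF N] submodule_reduce[OF N']
  have "y = \<zero>\<^bsub>free_module R r\<^esub>" if y: "y \<in> reduce r ` N \<inter> reduce r ` N'" for y
  proof -
    obtain x w where xw: "x \<in> N" "w \<in> N'" "y = reduce r x" "y = reduce r w"
      using y by blast
    obtain u where "x = m \<odot>\<^bsub>free_module \<Z> r\<^esub> u"
      using complement_reduce_eq[OF N N' inter sum xw(1,2)] xw(3,4) by auto
    then show ?thesis
      using xw(3) F.smult_l_null[OF reduce_mem] by (simp add: reduce_smult res_zero_eq)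
  qed
  then have "reduce r ` N \<inter> reduce r ` N' = {\<zero>\<^bsub>free_module R r\<^esub>}"
    using F.submodule_zero[OF sub(1)] F.submodule_zero[OF sub(2)] by blast
  moreover have "reduce r ` N <+>\<^bsub>free_module R r\<^esub> reduce r ` N' = carrier (free_module R r)"
  proof
    show "reduce r ` N <+>\<^bsub>free_module R r\<^esub> reduce r ` N' \<subseteq> carrier (free_module R r)"
      by (intro F.submodule_carrier F.submodule_set_add sub)
    show "carrier (free_module R r) \<subseteq> reduce r ` N <+>\<^bsub>free_module R r\<^esub> reduce r ` N'"
    proof
      fix w assume w: "w \<in> carrier (free_module R r)"
      \<comment> \<open>The residue vector \<open>w\<close> is decomposed as an integer vector and
        reduced afterwards.\<close>
      then obtain u u' where u: "u \<in> N" "u' \<in> N'" "w = u \<oplus>\<^bsub>free_module \<Z> r\<^esub> u'"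
        using residue_vector_lift(1)[OF w] unfolding sum[symmetric] set_add_def' by blast
      have "w = reduce r u \<oplus>\<^bsub>free_module R r\<^esub> reduce r u'"
        using residue_vector_lift(2)[OF w] u(3) reduce_add by simp
      with u show "w \<in> reduce r ` N <+>\<^bsub>free_module R r\<^esub> reduce r ` N'"
        unfolding set_add_def' by blast
    qed
  qed
  ultimately show ?thesis
    unfolding direct_summand_def using sub by blast
qed

text \<open>The difference \<open>x - y\<close> lies in \<open>N\<close> and reduces to zero, so
  \<open>complement_reduce_eq\<close> applies to it with the zero vector of
  \<open>N'\<close>.\<close>

lemma direct_summand_reduce_eq:
  assumes "direct_summand \<Z> (free_module \<Z> r) N" "x \<in> N" "y \<in> N" "reduce r x = reduce r y"
  shows "\<exists>u\<in>N. x = y \<oplus>\<^bsub>free_module \<Z> r\<^esub> m \<odot>\<^bsub>free_module \<Z> r\<^esub> u"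
proof -
  interpret Z: module \<Z> "free_module \<Z> r" by (rule module_Z)
  obtain N' where N: "submodule N \<Z> (free_module \<Z> r)" and N': "submodule N' \<Z> (free_module \<Z> r)"
    and inter: "N \<inter> N' = {\<zero>\<^bsub>free_module \<Z> r\<^esub>}"
    and sum: "N <+>\<^bsub>free_module \<Z> r\<^esub> N' = carrier (free_module \<Z> r)"
    using assms(1) unfolding direct_summand_def by blast
  note carr = subsetD[OF Z.submodule_carrier[OF N]]
  let ?d = "x \<oplus>\<^bsub>free_module \<Z> r\<^esub> (- 1) \<odot>\<^bsub>free_module \<Z> r\<^esub> y"
  have d: "?d \<in> N"
    using assms(2,3) by (auto intro!: Z.submoduleE(4,5) N)
  have "reduce r ?d = reduce r \<zero>\<^bsub>free_module \<Z> r\<^esub>"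
  proof -
    have "x i mod m = y i mod m" if "i < r" for i
      using fun_cong[OF assms(4), of i] that by (simp add: reduce_def)
    then have "(x i - y i) mod m = 0" if "i < r" for i
      using that by (simp add: mod_eq_dvd_iff)
    then show ?thesis
      by (auto simp: reduce_def free_module_def fun_eq_iff)
  qed
  then obtain u where u: "u \<in> N" "?d = m \<odot>\<^bsub>free_module \<Z> r\<^esub> u"
    using complement_reduce_eq[OF N N' inter sum d Z.submodule_zero[OF N']] by blast
  have "x i = y i + m * u i" if "i < r" for i
    using fun_cong[OF u(2), of i] that by (simp add: free_module_def)
  then have "x = y \<oplus>\<^bsub>free_module \<Z> r\<^esub> m \<odot>\<^bsub>free_module \<Z> r\<^esub> u"
    using carr assms(2,3) u
    by (intro free_module_ext[of _ \<Z> r] Z.M.a_closed Z.smult_closed) (simp_all add: free_module_def)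
  with u(1) show ?thesis by blast
qed

text \<open>The reduction of a basis is a basis. Spanning is inherited. If two combinations have
  equal reductions, they differ by \<open>m u\<close> with \<open>u\<close> in \<open>N\<close>;
  expanding \<open>u\<close> in the basis shows that the integral coefficients differ by multiples
  of \<open>m\<close>. That step uses that \<open>N\<close> is a direct summand.\<close>

lemma has_rank_reduce:
  assumes ds: "direct_summand \<Z> (free_module \<Z> r) N" and "has_rank \<Z> (free_module \<Z> r) N k"
  shows "has_rank R (free_module R r) (reduce r ` N) k"
proof -
  interpret Z: module \<Z> "free_module \<Z> r" by (rule module_Z)
  interpret F: module R "free_module R r" by (rule module_R)
  let ?Z = "free_module \<Z> r" and ?F = "free_module R r"
  have N: "submodule N \<Z> ?Z"
    using ds by (simp add: direct_summand_def)
  obtain B where basis: "module_basis \<Z> ?Z N B" and k: "card B = k"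
    using assms(2) unfolding has_rank_def by blast
  then have B: "finite B" "B \<subseteq> N"
    by (simp_all add: module_basis_def)
  \<comment> \<open>Evaluation is defined on all integer functions, of which only the values on
    \<open>B\<close> matter; coefficients can then be added and scaled without restricting them each
    time.\<close>
  define S where "S c = (\<Oplus>\<^bsub>?Z\<^esub>b\<in>B. c b \<odot>\<^bsub>?Z\<^esub> b)" for c
  have uniq: "\<exists>!c. c \<in> B \<rightarrow>\<^sub>E carrier \<Z> \<and> x = S c" if "x \<in> N" for x
    using basis that unfolding module_basis_def S_def by simp
  have Bc: "b \<in> carrier ?Z" if "b \<in> B" for b
    using that B(2) Z.submodule_carrier[OF N] by blast
  have S_cong: "S c = S d" if "\<And>b. b \<in> B \<Longrightarrow> c b = d b" for c d
    unfolding S_def using that Bc by (intro Z.M.finsum_cong') (auto intro!: Z.smult_closed)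
  have S_mem: "S c \<in> N" for c
    unfolding S_def using B by (intro Z.submodule_finsum[OF N]) (auto intro!: Z.submoduleE(4)[OF N])
  have S_inj: "c b = d b" if "S c = S d" "b \<in> B" for c d b
  proof -
    \<comment> \<open>Uniqueness of coefficients concerns extensional functions, so \<open>c\<close>
      and \<open>d\<close> are first cut down to \<open>B\<close>.\<close>
    have "S (restrict c B) = S c" "S (restrict d B) = S d"
      by (rule S_cong; simp)+
    then have "restrict c B = restrict d B"
      using uniq[OF S_mem[of c]] that(1) by (elim ex1E) (metis restrict_PiE_iff int_Zcarr)
    then show ?thesis
      using that(2) by (metis restrict_apply')
  qed
  have S_add: "S c \<oplus>\<^bsub>?Z\<^esub> m \<odot>\<^bsub>?Z\<^esub> S d = S (\<lambda>b. c b + m * d b)" for c d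
  proof -
    have "m \<odot>\<^bsub>?Z\<^esub> S d = (\<Oplus>\<^bsub>?Z\<^esub>b\<in>B. m \<odot>\<^bsub>?Z\<^esub> (d b \<odot>\<^bsub>?Z\<^esub> b))"
      unfolding S_def using B Bc by (intro Z.finsum_smult_ldistr) (auto intro!: Z.smult_closed)
    then have "S c \<oplus>\<^bsub>?Z\<^esub> m \<odot>\<^bsub>?Z\<^esub> S d = (\<Oplus>\<^bsub>?Z\<^esub>b\<in>B. c b \<odot>\<^bsub>?Z\<^esub> b \<oplus>\<^bsub>?Z\<^esub> m \<odot>\<^bsub>?Z\<^esub> (d b \<odot>\<^bsub>?Z\<^esub> b))"
      unfolding S_def using Bc by (subst Z.M.finsum_addf) (auto intro!: Z.smult_closed)
    also have "\<dots> = S (\<lambda>b. c b + m * d b)"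
      unfolding S_def using Bc
      by (intro Z.M.finsum_cong' refl)
        (auto simp: free_module_def fun_eq_iff algebra_simps)
    finally show ?thesis .
  qed
  have S_reduce: "c b mod m = d b mod m" if eq: "reduce r (S c) = reduce r (S d)" and b: "b \<in> B" for c d b
  proof -
    obtain u where u: "u \<in> N" "S c = S d \<oplus>\<^bsub>?Z\<^esub> m \<odot>\<^bsub>?Z\<^esub> u"
      using direct_summand_reduce_eq[OF ds S_mem S_mem eq] by blast
    obtain e where "u = S e"
      using ex1_implies_ex[OF uniq[OF u(1)]] by blast
    then have "c b = d b + m * e b"
      using u(2) S_add S_inj[OF _ b] by simp
    then show ?thesis by simp
  qed
  have reduce_S: "reduce r (S c) = (\<Oplus>\<^bsub>?F\<^esub>b\<in>B. (c b mod m) \<odot>\<^bsub>?F\<^esub> reduce r b)" for c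
    unfolding S_def using B Bc by (intro reduce_finsum) auto
  have "has_rank R ?F (reduce r ` N) (card B)"
  proof (rule F.has_rankI_family)
    show "inj_on (reduce r) B"
    proof (rule inj_onI)
      fix a b assume ab: "a \<in> B" "b \<in> B" "reduce r a = reduce r b"
      have delta: "S (\<lambda>x. if x = b then 1 else 0) = b" if "b \<in> B" for b
      proof -
        have "S (\<lambda>x. if x = b then 1 else 0) = (\<Oplus>\<^bsub>?Z\<^esub>x\<in>B. if b = x then x else \<zero>\<^bsub>?Z\<^esub>)"
          unfolding S_def using Bc Z.smult_l_null Z.smult_one
          by (intro Z.M.finsum_cong') auto
        also have "\<dots> = b"
          using Z.M.finsum_singleton[of b B "\<lambda>x. x"] that B Bc by auto
        finally show ?thesis .
      qed
      \<comment> \<open>The vectors \<open>a\<close> and \<open>b\<close> are the values of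
        \<open>S\<close> at their indicator functions. Comparing coefficients at \<open>a\<close>
        would give 1 congruent to 0 if \<open>a\<close> and \<open>b\<close> differed, which
        \<open>m > 1\<close> excludes.\<close>
      have "(if a = a then 1 else 0 :: int) mod m = (if a = b then 1 else 0) mod m"
        using S_reduce[of "\<lambda>x. if x = a then 1 else 0" "\<lambda>x. if x = b then 1 else 0" a]
          ab by (simp only: delta)
      then show "a = b"
        using m_gt_one by (auto split: if_splits)
    qed
    show "reduce r ` N \<subseteq> carrier ?F"
      using reduce_mem by blast
    fix y assume "y \<in> reduce r ` N"
    then obtain x where x: "x \<in> N" "y = reduce r x" by blast
    obtain c where c: "x = S c"
      using ex1_implies_ex[OF uniq[OF x(1)]] by blast
    let ?c = "\<lambda>b\<in>B. c b mod m"
    \<comment> \<open>Coefficients in \<open>R\<close> are unchanged by \<open>mod m\<close>, so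
      they are their own integral lifts and \<open>reduce_S\<close> applies.\<close>
    have lift: "(\<Oplus>\<^bsub>?F\<^esub>b\<in>B. d b \<odot>\<^bsub>?F\<^esub> reduce r b) = reduce r (S d)" if "d \<in> B \<rightarrow>\<^sub>E carrier R" for d
      unfolding reduce_S using that
      by (intro F.M.finsum_cong') (auto simp: mod_eq_carrier[OF PiE_mem[OF that]] intro!: F.smult_closed reduce_mem)
    have mem: "?c \<in> B \<rightarrow>\<^sub>E carrier R"
      by simp
    show "\<exists>!d. d \<in> B \<rightarrow>\<^sub>E carrier R \<and> y = (\<Oplus>\<^bsub>?F\<^esub>b\<in>B. d b \<odot>\<^bsub>?F\<^esub> reduce r b)"
    proof (rule ex1I, rule conjI)
      show "?c \<in> B \<rightarrow>\<^sub>E carrier R" by (rule mem)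
      have "y = (\<Oplus>\<^bsub>?F\<^esub>b\<in>B. (c b mod m) \<odot>\<^bsub>?F\<^esub> reduce r b)"
        unfolding x(2) c by (rule reduce_S)
      also have "\<dots> = (\<Oplus>\<^bsub>?F\<^esub>b\<in>B. ?c b \<odot>\<^bsub>?F\<^esub> reduce r b)"
        by (intro F.M.finsum_cong') (auto intro!: F.smult_closed reduce_mem)
      finally show "y = (\<Oplus>\<^bsub>?F\<^esub>b\<in>B. ?c b \<odot>\<^bsub>?F\<^esub> reduce r b)" .
    next
      fix d assume d: "d \<in> B \<rightarrow>\<^sub>E carrier R \<and> y = (\<Oplus>\<^bsub>?F\<^esub>b\<in>B. d b \<odot>\<^bsub>?F\<^esub> reduce r b)"
      then have "reduce r (S d) = reduce r (S c)"
        using lift[of d] x(2) c by simp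
      then have "d b mod m = c b mod m" if "b \<in> B" for b
        using S_reduce that by blast
      moreover have "d b mod m = d b" if "b \<in> B" for b
        using conjunct1[OF d] that by (intro mod_eq_carrier) auto
      ultimately show "d = ?c"
        using conjunct1[OF d] mem by (intro PiE_ext[of d B "\<lambda>_. carrier R"]) simp_all
    qed
  qed (use B in auto)
  with k show ?thesis by simp
qed

lemma lines_reduce: "l \<in> lines \<Z> (free_module \<Z> r) \<Longrightarrow> reduce r ` l \<in> lines R (free_module R r)"
  by (simp add: lines_def direct_summand_reduce has_rank_reduce)

lemma card_carrier: "card (carrier R) = nat m"
  using m_gt_one by (simp add: res_carrier_eq)

text \<open>Reduction cannot identify two lines of a simplex: fewer than \<open>k\<close> lines
  span at most \<open>m ^ (k - 1)\<close> vectors, while the reduced span has \<open>m ^ k\<close>.\<close>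

lemma universal_complex_reduce:
  assumes "L \<in> universal_complex \<Z> r"
  shows "(`) (reduce r) ` L \<in> universal_complex R r" "inj_on ((`) (reduce r)) L"
proof -
  interpret Z: module \<Z> "free_module \<Z> r" by (rule module_Z)
  interpret F: module R "free_module R r" by (rule module_R)
  let ?L = "(`) (reduce r) ` L"
  let ?N = "module_span R (free_module R r) (\<Union>?L)"
  have L: "finite L" "L \<subseteq> lines \<Z> (free_module \<Z> r)"
    and span: "direct_summand \<Z> (free_module \<Z> r) (module_span \<Z> (free_module \<Z> r) (\<Union>L))"
      "has_rank \<Z> (free_module \<Z> r) (module_span \<Z> (free_module \<Z> r) (\<Union>L)) (card L)"
    using assms unfolding universal_complex_def Let_def by auto
  have "l \<subseteq> carrier (free_module \<Z> r)" if "l \<in> L" for l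
    using that L(2) Z.submodule_carrier unfolding lines_def direct_summand_def by blast
  then have "?N = reduce r ` module_span \<Z> (free_module \<Z> r) (\<Union>L)"
    by (subst span_reduce[symmetric]) (auto simp: image_Union)
  then have N: "direct_summand R (free_module R r) ?N" "has_rank R (free_module R r) ?N (card L)"
    using direct_summand_reduce[OF span(1)] has_rank_reduce[OF span] by simp_all
  have lines: "?L \<subseteq> lines R (free_module R r)"
    using L(2) lines_reduce by blast
  have l: "submodule l R (free_module R r)" "card l = nat m" if "l \<in> ?L" for l
    using that lines F.card_of_rank[of l 1] unfolding lines_def direct_summand_def
    by (auto simp: card_carrier)
  have "nat m ^ card L = card ?N"
    using F.card_of_rank[OF _ N(2)] N(1) by (simp add: direct_summand_def card_carrier)
  \<comment> \<open>Each reduced line has the positive cardinality \<open>nat m\<close> and is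
    therefore finite, as the counting lemma requires.\<close>
  also have "\<dots> \<le> (\<Prod>l\<in>?L. card l)"
    using F.span_Union_card_le[of ?L] L(1) l m_gt_one
    by (metis card_ge_0_finite finite_imageI zero_less_nat_eq zero_less_one order.strict_trans)
  also have "\<dots> = nat m ^ card ?L"
    using l by simp
  finally have "card L \<le> card ?L"
    using m_gt_one by (simp add: power_increasing_iff)
  with card_image_le[OF L(1)] have card: "card ?L = card L"
    by (metis le_antisym)
  then show "inj_on ((`) (reduce r)) L"
    using L(1) by (intro eq_card_imp_inj_on)
  show "?L \<in> universal_complex R r"
    unfolding universal_complex_def Let_def using L(1) lines N card by simp
qed

lemma nondegenerate_map_reduce:
  assumes "nondegenerate_map K (universal_complex \<Z> r) f"
  shows "nondegenerate_map K (universal_complex R r) ((`) (reduce r) \<circ> f)"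
  using assms universal_complex_reduce
  unfolding nondegenerate_map_def simplicial_map_def image_comp[symmetric] by (simp add: comp_inj_on)

end

section \<open>Comparison of the integral and the modular invariant\<close>

text \<open>Composition with reduction makes the least rank over \<open>\<Z>\<close> admissible over
  the residue ring. Ranks enter the invariants with a minus sign, which reverses the
  inequality.\<close>

lemma buchstaber_le_buchstaber_over_residue_ring:
  assumes "abstract_simplicial_complex V K" "finite V" "n > 1"
  shows "buchstaber K \<le> buchstaber_over (residue_ring n) K"
proof -
  interpret residues n "residue_ring n"
    by unfold_locales (use assms(3) in simp_all)
  let ?P = "\<lambda>r. \<exists>f. nondegenerate_map K (universal_complex \<Z> r) f"
  have "?P (card V)"
    using nondegenerate_map_universal_complex_exists[OF int_is_cring _ assms(1,2)] by simp
  then have "?P (LEAST r. ?P r)"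
    by (rule LeastI)
  then have "(LEAST r. \<exists>f. nondegenerate_map K (universal_complex (residue_ring n) r) f) \<le> (LEAST r. ?P r)"
    using nondegenerate_map_reduce by (intro Least_le) blast
  then show ?thesis
    unfolding buchstaber_def buchstaber_over_def by simp
qed

section \<open>Counting lines over a finite field\<close>

text \<open>If \<open>b\<close> is a basis of the line and \<open>x = a b\<close> is nonzero, then
  \<open>a\<close> is a unit and every \<open>d b\<close> equals \<open>(d / a) x\<close>.
  Consequently two lines sharing a nonzero vector coincide.\<close>

lemma line_eq_multiples:
  assumes "field F" "module F M" "l \<in> lines F M" "x \<in> l" "x \<noteq> \<zero>\<^bsub>M\<^esub>"
  shows "l = (\<lambda>a. a \<odot>\<^bsub>M\<^esub> x) ` carrier F"
proof -
  interpret F: field F by fact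
  interpret module F M by fact
  have l: "submodule l F M"
    using assms(3) by (simp add: lines_def direct_summand_def)
  note carr = subsetD[OF submodule_carrier[OF l]]
  obtain b where basis: "module_basis F M l {b}"
    using assms(3) unfolding lines_def has_rank_def by (auto simp: card_1_singleton_iff)
  then have b: "b \<in> l" "b \<in> carrier M"
    using carr by (auto simp: module_basis_def)
  have ex: "\<exists>a\<in>carrier F. y = a \<odot>\<^bsub>M\<^esub> b" if "y \<in> l" for y
  proof -
    have "\<exists>!c. c \<in> {b} \<rightarrow>\<^sub>E carrier F \<and> y = (\<Oplus>\<^bsub>M\<^esub>b\<in>{b}. c b \<odot>\<^bsub>M\<^esub> b)"
      using basis that unfolding module_basis_def by blast
    then obtain c where c: "c \<in> {b} \<rightarrow>\<^sub>E carrier F" "y = (\<Oplus>\<^bsub>M\<^esub>b\<in>{b}. c b \<odot>\<^bsub>M\<^esub> b)"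
      by (elim ex1E conjE)
    have "c b \<in> carrier F"
      using c(1) by auto
    then have "(\<Oplus>\<^bsub>M\<^esub>b\<in>{b}. c b \<odot>\<^bsub>M\<^esub> b) = c b \<odot>\<^bsub>M\<^esub> b"
      using b(2) by (subst M.finsum_insert) auto
    then show ?thesis
      using c(2) \<open>c b \<in> carrier F\<close> by auto
  qed
  obtain a where a: "a \<in> carrier F" "x = a \<odot>\<^bsub>M\<^esub> b"
    using ex[OF assms(4)] by blast
  with assms(5) b have unit: "a \<in> Units F"
    by (auto simp: F.field_Units)
  show ?thesis
  proof
    show "(\<lambda>a. a \<odot>\<^bsub>M\<^esub> x) ` carrier F \<subseteq> l"
      using submoduleE(4)[OF l] assms(4) by blast
    show "l \<subseteq> (\<lambda>a. a \<odot>\<^bsub>M\<^esub> x) ` carrier F"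
    proof
      fix y assume "y \<in> l"
      then obtain d where d: "d \<in> carrier F" "y = d \<odot>\<^bsub>M\<^esub> b"
        using ex by blast
      have "(d \<otimes>\<^bsub>F\<^esub> inv\<^bsub>F\<^esub> a) \<odot>\<^bsub>M\<^esub> x = (d \<otimes>\<^bsub>F\<^esub> inv\<^bsub>F\<^esub> a \<otimes>\<^bsub>F\<^esub> a) \<odot>\<^bsub>M\<^esub> b"
        using a b d unit by (simp add: smult_assoc1)
      also have "\<dots> = y"
        using a d unit by (simp add: F.m_assoc)
      finally show "y \<in> (\<lambda>a. a \<odot>\<^bsub>M\<^esub> x) ` carrier F"
        using d unit by (intro image_eqI[of _ _ "d \<otimes>\<^bsub>F\<^esub> inv\<^bsub>F\<^esub> a"]) auto
    qed
  qed
qed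

text \<open>With \<open>q\<close> the size of the field, removing zero leaves \<open>q - 1\<close>
  vectors on each line. These sets are pairwise disjoint, since a common vector would generate both
  lines, and they all lie among the \<open>q ^ r - 1\<close> nonzero vectors.\<close>

lemma card_lines_le:
  assumes "field F" "finite (carrier F)"
  shows "finite (lines F (free_module F r))"
    and "(card (carrier F) - 1) * card (lines F (free_module F r)) \<le> card (carrier F) ^ r - 1"
proof -
  interpret F: field F by fact
  let ?M = "free_module F r" and ?q = "card (carrier F)"
  have mod: "module F ?M"
    by (rule free_module_is_module[OF F.is_cring])
  interpret module F ?M by (rule mod)
  have fin: "finite (carrier ?M)"
    using assms(2) by (auto simp: free_module_def intro: finite_PiE)
  have line: "submodule l F ?M" "l \<subseteq> carrier ?M" "card l = ?q" if "l \<in> lines F ?M" for l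
    using that submodule_carrier[of l] card_of_rank[of l 1] by (auto simp: lines_def direct_summand_def)
  then show fin_lines: "finite (lines F ?M)"
    using fin by (auto intro: finite_subset[of _ "Pow (carrier ?M)"])
  have "card (l - {\<zero>\<^bsub>?M\<^esub>}) = ?q - 1" if "l \<in> lines F ?M" for l
    using line[OF that] submodule_zero by (simp add: card_Diff_singleton)
  then have "(?q - 1) * card (lines F ?M) = (\<Sum>l\<in>lines F ?M. card (l - {\<zero>\<^bsub>?M\<^esub>}))"
    by simp
  also have "\<dots> = card (\<Union>l\<in>lines F ?M. l - {\<zero>\<^bsub>?M\<^esub>})"
  proof (rule card_UN_disjoint[symmetric])
    show "\<forall>l\<in>lines F ?M. finite (l - {\<zero>\<^bsub>?M\<^esub>})"
      using line(2) fin by (blast intro: finite_subset)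
    show "\<forall>l\<in>lines F ?M. \<forall>l'\<in>lines F ?M. l \<noteq> l' \<longrightarrow> (l - {\<zero>\<^bsub>?M\<^esub>}) \<inter> (l' - {\<zero>\<^bsub>?M\<^esub>}) = {}"
      using line_eq_multiples[OF assms(1) mod] by blast
  qed (rule fin_lines)
  also have "\<dots> \<le> card (carrier ?M - {\<zero>\<^bsub>?M\<^esub>})"
    using line(2) fin by (intro card_mono) auto
  also have "\<dots> = ?q ^ r - 1"
    using fin by (simp add: card_Diff_singleton) (simp add: free_module_def card_PiE)
  finally show "(?q - 1) * card (lines F ?M) \<le> ?q ^ r - 1" .
qed

section \<open>Colourings by lines and the logarithmic bound\<close>

text \<open>Numbering the lines turns the map into a colouring: it is injective on each simplex, and
  every set of numbers is a simplex of the full simplex.\<close>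

lemma chromatic_number_le_card_lines:
  assumes "nondegenerate_map K (universal_complex R r) f" "finite (lines R (free_module R r))"
  shows "chromatic_number K \<le> card (lines R (free_module R r))"
proof -
  let ?L = "lines R (free_module R r)"
  obtain h where h: "bij_betw h ?L {..<card ?L}"
    using ex_bij_betw_finite_nat[OF assms(2)] by (auto simp: atLeast0LessThan)
  have "(h \<circ> f) ` \<sigma> \<in> full_simplex (card ?L)" "inj_on (h \<circ> f) \<sigma>" if "\<sigma> \<in> K" for \<sigma>
  proof -
    have f: "f ` \<sigma> \<subseteq> ?L" "inj_on f \<sigma>"
      using assms(1) that
      by (auto simp: nondegenerate_map_def simplicial_map_def universal_complex_def Let_def)
    show "(h \<circ> f) ` \<sigma> \<in> full_simplex (card ?L)"
      using f(1) bij_betwE[OF h] by (auto simp: full_simplex_def)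
    show "inj_on (h \<circ> f) \<sigma>"
      using f(2) inj_on_subset[OF bij_betw_imp_inj_on[OF h] f(1)] by (rule comp_inj_on)
  qed
  then have "nondegenerate_map K (full_simplex (card ?L)) (h \<circ> f)"
    by (simp add: nondegenerate_map_def simplicial_map_def)
  then show ?thesis
    unfolding chromatic_number_def by (intro Least_le) blast
qed

theorem corollary5p10:
  fixes m p :: nat and K :: "nat set set"
  assumes "abstract_simplicial_complex {1..m} K"
    and "prime p"
  shows "buchstaber K \<le> mod_buchstaber p K \<and>
         mod_buchstaber p K
           \<le> int m - \<lceil>log (real p) ((real p - 1) * real (chromatic_number K) + 1)\<rceil>"
proof
  have p: "p > 1"
    using assms(2) by (rule prime_gt_1_nat)
  interpret residues_prime p "residue_ring (int p)"
    by unfold_locales (use assms(2) in simp_all)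
  show "buchstaber K \<le> mod_buchstaber p K"
    unfolding mod_buchstaber_def
    using buchstaber_le_buchstaber_over_residue_ring[OF assms(1)] p by simp
  let ?P = "\<lambda>r. \<exists>f. nondegenerate_map K (universal_complex (residue_ring (int p)) r) f"
  let ?r = "LEAST r. ?P r" and ?g = "chromatic_number K"
  let ?L = "lines (residue_ring (int p)) (free_module (residue_ring (int p)) ?r)"
  \<comment> \<open>An admissible rank must be exhibited before \<open>LeastI\<close> can supply a
    map at the least one.\<close>
  have "?P (card {1..m})"
    using assms(1) p
    by (intro nondegenerate_map_universal_complex_exists cring) (auto simp: res_one_eq res_zero_eq)
  then have "?P ?r"
    by (rule LeastI)
  then obtain f where f: "nondegenerate_map K (universal_complex (residue_ring (int p)) ?r) f"
    by blast
  have q: "card (carrier (residue_ring (int p))) = p"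
    by (simp add: res_carrier_eq)
  have fin: "finite (carrier (residue_ring (int p)))"
    by (simp add: res_carrier_eq)
  have "(p - 1) * ?g \<le> (p - 1) * card ?L"
    using chromatic_number_le_card_lines[OF f card_lines_le(1)[OF is_field fin]] by simp
  also have "\<dots> \<le> p ^ ?r - 1"
    using card_lines_le(2)[OF is_field fin] q by simp
  \<comment> \<open>The subtraction on the right is truncated; moving the 1 across is sound because
    \<open>p ^ ?r\<close> is at least 1.\<close>
  finally have "(p - 1) * ?g + 1 \<le> p ^ ?r"
    using p by (simp add: le_diff_conv2)
  then have "real ((p - 1) * ?g + 1) \<le> real (p ^ ?r)"
    by (rule of_nat_mono)
  then have le: "(real p - 1) * real ?g + 1 \<le> real p ^ ?r"
    using p by (simp add: of_nat_diff)
  \<comment> \<open>The summand 1 keeps the argument of the logarithm positive even for the complex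
    without vertices, whose chromatic number is 0.\<close>
  have "0 < (real p - 1) * real ?g + 1"
    using p by (intro add_nonneg_pos) simp_all
  then have "log (real p) ((real p - 1) * real ?g + 1) \<le> log (real p) (real p ^ ?r)"
    using p le by (subst log_le_cancel_iff) auto
  also have "\<dots> = real ?r"
    using p by (simp add: log_nat_power)
  \<comment> \<open>The bound \<open>?r\<close> is an integer, so it also bounds the
    ceiling.\<close>
  finally have "\<lceil>log (real p) ((real p - 1) * real ?g + 1)\<rceil> \<le> int ?r"
    by (simp add: ceiling_le_iff)
  \<comment> \<open>The invariant counts vertices as \<open>card (\<Union>K)\<close>, which thereby
    becomes \<open>m\<close>.\<close>
  moreover have "\<Union>K = {1..m}"
    using assms(1) by (auto simp: abstract_simplicial_complex_def)
  ultimately show "mod_buchstaber p K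
      \<le> int m - \<lceil>log (real p) ((real p - 1) * real ?g + 1)\<rceil>"
    by (simp add: mod_buchstaber_def buchstaber_over_def)
qed

end
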